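(* Let $\mathcal C$ be a prenormal category, and consider in $\mathcal C$ a commutative diagram consisting of two adjacent squares: a top row $A\xrightarrow{f}B\xrightarrow{g}C$, a bottom row $A'\xrightarrow{f'}B'\xrightarrow{g'}C'$, and vertical morphisms $a\colon A\to A'$, $b\colon B\to B'$, $c\colon C\to C'$ with $b\circ f=f'\circ a$ and $c\circ g=g'\circ b$. Suppose that $f'$ is a normal epimorphism and that both the outer rectangle (with sides $g\circ f$, $c$, $a$, $g'\circ f'$) and the left-hand square (with sides $f,b,a,f'$) are pullbacks. Then the right-hand square (with sides $g,c,b,g'$) is also a pullback.
   Context: A pointed category is a category with a zero object. In a pointed category, a normal epimorphism is a morphism that is a cokernel of some morphism. A prenormal category is a pointed category $\mathcal C$ such that: (1) $\mathcal C$ has finite limits; (2) $\mathcal C$ has cokernels of kernels (every morphism which is a kernel has a cokernel); (3) normal epimorphisms are pullback-stable in $\mathcal C$ (the pullback of a normal epimorphism along any morphism is a normal epimorphism). *)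

theory Defs imports Main begin

text \<open>
  A category with explicit object and arrow carriers. Composition \<open>g \<cdot>\<^bsub>C\<^esub> f\<close> is in applicative
  order (first \<open>f\<close>, then \<open>g\<close>) and is meaningful only when \<open>Cod\<^bsub>C\<^esub> f = Dom\<^bsub>C\<^esub> g\<close>.
\<close>

record ('o, 'm) cat =
  Obj :: "'o set"
  Arr :: "'m set"
  Dom :: "'m \<Rightarrow> 'o" ("Dom\<index>")
  Cod :: "'m \<Rightarrow> 'o" ("Cod\<index>")
  Ident :: "'o \<Rightarrow> 'm" ("\<one>\<index>")
  Comp :: "'m \<Rightarrow> 'm \<Rightarrow> 'm" (infixr "\<cdot>\<index>" 70)

definition hom :: "('o, 'm) cat \<Rightarrow> 'o \<Rightarrow> 'o \<Rightarrow> 'm set" where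
  "hom C A B = {f \<in> Arr C. Dom\<^bsub>C\<^esub> f = A \<and> Cod\<^bsub>C\<^esub> f = B}"

locale category =
  fixes C :: "('o, 'm) cat" (structure)
  assumes dom_closed: "f \<in> Arr C \<Longrightarrow> Dom f \<in> Obj C"
    and cod_closed: "f \<in> Arr C \<Longrightarrow> Cod f \<in> Obj C"
    and id_in_hom: "A \<in> Obj C \<Longrightarrow> \<one> A \<in> hom C A A"
    and comp_in_hom: "\<lbrakk>f \<in> hom C A B; g \<in> hom C B D\<rbrakk> \<Longrightarrow> g \<cdot> f \<in> hom C A D"
    and id_right: "f \<in> hom C A B \<Longrightarrow> f \<cdot> \<one> A = f"
    and id_left: "f \<in> hom C A B \<Longrightarrow> \<one> B \<cdot> f = f"
    and comp_assoc:
      "\<lbrakk>f \<in> hom C A B; g \<in> hom C B D; h \<in> hom C D E\<rbrakk> \<Longrightarrow> (h \<cdot> g) \<cdot> f = h \<cdot> (g \<cdot> f)"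

locale cat_functor =
  source: category J + target: category C
  for J :: "('i, 'j) cat" and C :: "('o, 'm) cat"
    and Fo :: "'i \<Rightarrow> 'o" and Fa :: "'j \<Rightarrow> 'm" +
  assumes obj_closed: "i \<in> Obj J \<Longrightarrow> Fo i \<in> Obj C"
    and arr_closed: "u \<in> hom J i j \<Longrightarrow> Fa u \<in> hom C (Fo i) (Fo j)"
    and preserves_id: "i \<in> Obj J \<Longrightarrow> Fa (\<one>\<^bsub>J\<^esub> i) = \<one>\<^bsub>C\<^esub> (Fo i)"
    and preserves_comp:
      "\<lbrakk>u \<in> hom J i j; v \<in> hom J j k\<rbrakk> \<Longrightarrow> Fa (v \<cdot>\<^bsub>J\<^esub> u) = Fa v \<cdot>\<^bsub>C\<^esub> Fa u"

definition is_cone ::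
  "('i, 'j) cat \<Rightarrow> ('o, 'm) cat \<Rightarrow> ('i \<Rightarrow> 'o) \<Rightarrow> ('j \<Rightarrow> 'm) \<Rightarrow> 'o \<Rightarrow> ('i \<Rightarrow> 'm) \<Rightarrow> bool" where
  "is_cone J C Fo Fa X x \<longleftrightarrow>
     X \<in> Obj C \<and> (\<forall>i\<in>Obj J. x i \<in> hom C X (Fo i)) \<and>
     (\<forall>u\<in>Arr J. Fa u \<cdot>\<^bsub>C\<^esub> x (Dom\<^bsub>J\<^esub> u) = x (Cod\<^bsub>J\<^esub> u))"

definition is_limit ::
  "('i, 'j) cat \<Rightarrow> ('o, 'm) cat \<Rightarrow> ('i \<Rightarrow> 'o) \<Rightarrow> ('j \<Rightarrow> 'm) \<Rightarrow> 'o \<Rightarrow> ('i \<Rightarrow> 'm) \<Rightarrow> bool" where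
  "is_limit J C Fo Fa L l \<longleftrightarrow>
     is_cone J C Fo Fa L l \<and>
     (\<forall>X x. is_cone J C Fo Fa X x \<longrightarrow>
        (\<exists>!h. h \<in> hom C X L \<and> (\<forall>i\<in>Obj J. l i \<cdot>\<^bsub>C\<^esub> h = x i)))"

text \<open>
  Every finite category is isomorphic to one whose objects and arrows are natural numbers,
  so letting the index category range over \<open>(nat, nat) cat\<close> covers all finite diagrams.
\<close>

definition has_finite_limits :: "('o, 'm) cat \<Rightarrow> bool" where
  "has_finite_limits C \<longleftrightarrow>
     (\<forall>(J :: (nat, nat) cat) Fo Fa.
        finite (Obj J) \<and> finite (Arr J) \<and> cat_functor J C Fo Fa \<longrightarrow>
        (\<exists>L l. is_limit J C Fo Fa L l))"

definition is_initial :: "('o, 'm) cat \<Rightarrow> 'o \<Rightarrow> bool" where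
  "is_initial C Z \<longleftrightarrow> Z \<in> Obj C \<and> (\<forall>X\<in>Obj C. \<exists>!f. f \<in> hom C Z X)"

definition is_terminal :: "('o, 'm) cat \<Rightarrow> 'o \<Rightarrow> bool" where
  "is_terminal C Z \<longleftrightarrow> Z \<in> Obj C \<and> (\<forall>X\<in>Obj C. \<exists>!f. f \<in> hom C X Z)"

definition is_zero_object :: "('o, 'm) cat \<Rightarrow> 'o \<Rightarrow> bool" where
  "is_zero_object C Z \<longleftrightarrow> is_initial C Z \<and> is_terminal C Z"

locale pointed_category = category +
  assumes has_zero_object: "\<exists>Z. is_zero_object C Z"

definition is_zero_arrow :: "('o, 'm) cat \<Rightarrow> 'm \<Rightarrow> bool" where
  "is_zero_arrow C f \<longleftrightarrow>
     f \<in> Arr C \<and>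
     (\<exists>Z u v. is_zero_object C Z \<and> u \<in> hom C (Dom\<^bsub>C\<^esub> f) Z \<and> v \<in> hom C Z (Cod\<^bsub>C\<^esub> f) \<and>
        f = v \<cdot>\<^bsub>C\<^esub> u)"

definition is_kernel_of :: "('o, 'm) cat \<Rightarrow> 'm \<Rightarrow> 'm \<Rightarrow> bool" where
  "is_kernel_of C k f \<longleftrightarrow>
     k \<in> Arr C \<and> f \<in> Arr C \<and> Cod\<^bsub>C\<^esub> k = Dom\<^bsub>C\<^esub> f \<and> is_zero_arrow C (f \<cdot>\<^bsub>C\<^esub> k) \<and>
     (\<forall>x\<in>Arr C. Cod\<^bsub>C\<^esub> x = Dom\<^bsub>C\<^esub> f \<and> is_zero_arrow C (f \<cdot>\<^bsub>C\<^esub> x) \<longrightarrow>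
        (\<exists>!h. h \<in> hom C (Dom\<^bsub>C\<^esub> x) (Dom\<^bsub>C\<^esub> k) \<and> k \<cdot>\<^bsub>C\<^esub> h = x))"

definition is_cokernel_of :: "('o, 'm) cat \<Rightarrow> 'm \<Rightarrow> 'm \<Rightarrow> bool" where
  "is_cokernel_of C q f \<longleftrightarrow>
     q \<in> Arr C \<and> f \<in> Arr C \<and> Dom\<^bsub>C\<^esub> q = Cod\<^bsub>C\<^esub> f \<and> is_zero_arrow C (q \<cdot>\<^bsub>C\<^esub> f) \<and>
     (\<forall>x\<in>Arr C. Dom\<^bsub>C\<^esub> x = Cod\<^bsub>C\<^esub> f \<and> is_zero_arrow C (x \<cdot>\<^bsub>C\<^esub> f) \<longrightarrow>
        (\<exists>!h. h \<in> hom C (Cod\<^bsub>C\<^esub> q) (Cod\<^bsub>C\<^esub> x) \<and> h \<cdot>\<^bsub>C\<^esub> q = x))"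

definition is_normal_epi :: "('o, 'm) cat \<Rightarrow> 'm \<Rightarrow> bool" where
  "is_normal_epi C e \<longleftrightarrow> (\<exists>f. is_cokernel_of C e f)"

text \<open>
  \<open>is_pullback C p q f g\<close> says that the square \<open>f \<cdot>\<^bsub>C\<^esub> p = g \<cdot>\<^bsub>C\<^esub> q\<close> is a pullback of the cospan
  \<open>(f, g)\<close>; thus \<open>p\<close> is a pullback of \<open>g\<close> along \<open>f\<close>, and \<open>q\<close> a pullback of \<open>f\<close> along \<open>g\<close>.
\<close>

definition is_pullback :: "('o, 'm) cat \<Rightarrow> 'm \<Rightarrow> 'm \<Rightarrow> 'm \<Rightarrow> 'm \<Rightarrow> bool" where
  "is_pullback C p q f g \<longleftrightarrow>
     p \<in> Arr C \<and> q \<in> Arr C \<and> f \<in> Arr C \<and> g \<in> Arr C \<and>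
     Dom\<^bsub>C\<^esub> p = Dom\<^bsub>C\<^esub> q \<and> Cod\<^bsub>C\<^esub> p = Dom\<^bsub>C\<^esub> f \<and> Cod\<^bsub>C\<^esub> q = Dom\<^bsub>C\<^esub> g \<and> Cod\<^bsub>C\<^esub> f = Cod\<^bsub>C\<^esub> g \<and>
     f \<cdot>\<^bsub>C\<^esub> p = g \<cdot>\<^bsub>C\<^esub> q \<and>
     (\<forall>X. \<forall>x\<in>hom C X (Dom\<^bsub>C\<^esub> f). \<forall>y\<in>hom C X (Dom\<^bsub>C\<^esub> g). f \<cdot>\<^bsub>C\<^esub> x = g \<cdot>\<^bsub>C\<^esub> y \<longrightarrow>
        (\<exists>!h. h \<in> hom C X (Dom\<^bsub>C\<^esub> p) \<and> p \<cdot>\<^bsub>C\<^esub> h = x \<and> q \<cdot>\<^bsub>C\<^esub> h = y))"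

locale prenormal_category = pointed_category +
  assumes finite_limits: "has_finite_limits C"
    and cokernels_of_kernels: "is_kernel_of C k f \<Longrightarrow> \<exists>q. is_cokernel_of C q k"
    and normal_epis_pullback_stable:
      "\<lbrakk>is_normal_epi C e; is_pullback C p q f e\<rbrakk> \<Longrightarrow> is_normal_epi C p"

end

theory Submission imports Defs begin

text \<open>
  Let \<open>P\<close> be the pullback of \<open>c\<close> along \<open>g'\<close>, with projections \<open>p : P \<rightarrow> D\<close> and \<open>r : P \<rightarrow> B'\<close>, and let
  \<open>\<phi> : B \<rightarrow> P\<close> be the comparison arrow of the right-hand square; that square is a pullback as soon
  as \<open>\<phi>\<close> is invertible (\<open>pullback_precomp_iso\<close>). Cancelling \<open>P\<close> from the outer rectangle
  (\<open>pullback_cancel\<close>) shows that \<open>\<phi> \<cdot> f\<close> is a pullback of \<open>f'\<close> along \<open>r\<close>, just as \<open>f\<close> is a pullback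
  of \<open>f'\<close> along \<open>b = r \<cdot> \<phi>\<close>. Hence both \<open>f\<close> and \<open>\<phi> \<cdot> f\<close> are normal epimorphisms.

  Moreover \<open>f\<close> and \<open>\<phi> \<cdot> f\<close> have the same kernel: pulling back does not change kernels, so both are
  isomorphic to the kernel of \<open>f'\<close>, in either case by way of \<open>a\<close>. Two normal epimorphisms that kill
  the same arrows are cokernels of each other's defining arrows, so the arrow \<open>\<phi>\<close> between them is
  an isomorphism (\<open>factor_of_normal_epis_iso\<close>).

  Equality of kernels is phrased without kernel objects: \<open>f\<close> and \<open>\<phi> \<cdot> f\<close> kill the same arrows. One
  inclusion is immediate, the other is \<open>killed_by_composite_killed_by_pullback\<close>.
\<close>

section \<open>Pullbacks\<close>

context category
begin

lemma homD:
  assumes "f \<in> hom C A B"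
  shows "f \<in> Arr C" "Dom f = A" "Cod f = B" "A \<in> Obj C" "B \<in> Obj C"
  using assms dom_closed cod_closed by (auto simp: hom_def)

lemma is_pullbackI:
  assumes "p \<in> hom C P A" "q \<in> hom C P B" "f \<in> hom C A D" "g \<in> hom C B D"
    and "f \<cdot> p = g \<cdot> q"
    and "\<And>X x y. \<lbrakk>x \<in> hom C X A; y \<in> hom C X B; f \<cdot> x = g \<cdot> y\<rbrakk> \<Longrightarrow>
      \<exists>!h. h \<in> hom C X P \<and> p \<cdot> h = x \<and> q \<cdot> h = y"
  shows "is_pullback C p q f g"
  using assms(5,6) homD(1-3)[OF assms(1)] homD(1-3)[OF assms(2)] homD(1-3)[OF assms(3)]
    homD(1-3)[OF assms(4)] by (simp add: is_pullback_def)

lemma pullback_commutes: "is_pullback C p q f g \<Longrightarrow> f \<cdot> p = g \<cdot> q"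
  by (simp add: is_pullback_def)

lemma pullback_lift:
  assumes "is_pullback C p q f g" "p \<in> hom C P A" "q \<in> hom C P B"
    and "x \<in> hom C X A" "y \<in> hom C X B" "f \<cdot> x = g \<cdot> y"
  obtains h where "h \<in> hom C X P" "p \<cdot> h = x" "q \<cdot> h = y"
proof -
  have "A = Dom f" "B = Dom g" "P = Dom p"
    using assms(1-3) by (auto simp: is_pullback_def hom_def)
  then have "\<exists>!h. h \<in> hom C X P \<and> p \<cdot> h = x \<and> q \<cdot> h = y"
    using assms(1,4-6) unfolding is_pullback_def by blast
  with that show thesis by blast
qed

lemma pullback_jointly_monic:
  assumes pb: "is_pullback C p q f g" and p: "p \<in> hom C P A" and q: "q \<in> hom C P B"
    and h: "h \<in> hom C X P" and k: "k \<in> hom C X P"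
    and eq: "p \<cdot> h = p \<cdot> k" "q \<cdot> h = q \<cdot> k"
  shows "h = k"
proof -
  have f: "f \<in> hom C A (Cod f)" and g: "g \<in> hom C B (Cod f)" and P: "P = Dom p"
    and A: "A = Dom f" and B: "B = Dom g"
    using pb p q by (auto simp: is_pullback_def hom_def)
  have "f \<cdot> (p \<cdot> h) = g \<cdot> (q \<cdot> h)"
    using comp_assoc[OF h p f] comp_assoc[OF h q g] pullback_commutes[OF pb] by simp
  then have "\<exists>!m. m \<in> hom C X P \<and> p \<cdot> m = p \<cdot> h \<and> q \<cdot> m = q \<cdot> h"
    using pb comp_in_hom[OF h p] comp_in_hom[OF h q]
    unfolding is_pullback_def P A B by blast
  then show ?thesis using h k eq by metis
qed

text \<open>
  An arrow into \<open>P\<close> is determined by its components under \<open>p\<close> and \<open>r\<close>, so testing the left-hand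
  square amounts to testing the outer rectangle.
\<close>

lemma pullback_cancel:
  assumes u: "u \<in> hom C A P" and p: "p \<in> hom C P D" and a: "a \<in> hom C A A'"
    and r: "r \<in> hom C P B'" and c: "c \<in> hom C D D'"
    and f': "f' \<in> hom C A' B'" and g': "g' \<in> hom C B' D'"
    and comm: "r \<cdot> u = f' \<cdot> a"
    and right: "is_pullback C p r c g'"
    and outer: "is_pullback C (p \<cdot> u) a c (g' \<cdot> f')"
  shows "is_pullback C u a r f'"
proof (rule is_pullbackI[OF u a r f' comm])
  fix X x y assume x: "x \<in> hom C X P" and y: "y \<in> hom C X A'" and xy: "r \<cdot> x = f' \<cdot> y"
  note pu = comp_in_hom[OF u p]
  have "c \<cdot> (p \<cdot> x) = (g' \<cdot> f') \<cdot> y"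
    using comp_assoc[OF x p c] comp_assoc[OF x r g'] comp_assoc[OF y f' g']
      pullback_commutes[OF right] xy by simp
  then obtain h where h: "h \<in> hom C X A" and 1: "(p \<cdot> u) \<cdot> h = p \<cdot> x" and 2: "a \<cdot> h = y"
    using pullback_lift[OF outer pu a comp_in_hom[OF x p] y] by blast
  have "p \<cdot> (u \<cdot> h) = p \<cdot> x" using 1 comp_assoc[OF h u p] by simp
  moreover have "r \<cdot> (u \<cdot> h) = r \<cdot> x"
    using comp_assoc[OF h u r] comp_assoc[OF h a f'] comm xy 2 by simp
  ultimately have "u \<cdot> h = x"
    using pullback_jointly_monic[OF right p r comp_in_hom[OF h u] x] by blast
  moreover have "k = h" if "k \<in> hom C X A" "u \<cdot> k = x" "a \<cdot> k = y" for k
    using that 1 2 h pullback_jointly_monic[OF outer pu a] comp_assoc[OF _ u p] by metis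
  ultimately show "\<exists>!h. h \<in> hom C X A \<and> u \<cdot> h = x \<and> a \<cdot> h = y" using h 2 by blast
qed

lemma pullback_precomp_iso:
  assumes pb: "is_pullback C p r c g'" and p: "p \<in> hom C P D" and r: "r \<in> hom C P B'"
    and \<phi>: "\<phi> \<in> hom C B P" and \<psi>: "\<psi> \<in> hom C P B"
    and \<psi>\<phi>: "\<psi> \<cdot> \<phi> = \<one> B" and \<phi>\<psi>: "\<phi> \<cdot> \<psi> = \<one> P"
  shows "is_pullback C (p \<cdot> \<phi>) (r \<cdot> \<phi>) c g'"
proof -
  have c: "c \<in> hom C D (Cod c)" and g': "g' \<in> hom C B' (Cod c)"
    using pb p r by (auto simp: is_pullback_def hom_def)
  note p\<phi> = comp_in_hom[OF \<phi> p] and r\<phi> = comp_in_hom[OF \<phi> r]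
  show ?thesis
  proof (rule is_pullbackI[OF p\<phi> r\<phi> c g'])
    show "c \<cdot> p \<cdot> \<phi> = g' \<cdot> r \<cdot> \<phi>"
      using comp_assoc[OF \<phi> p c] comp_assoc[OF \<phi> r g'] pullback_commutes[OF pb] by simp
  next
    fix X x y assume x: "x \<in> hom C X D" and y: "y \<in> hom C X B'" and xy: "c \<cdot> x = g' \<cdot> y"
    obtain m where m: "m \<in> hom C X P" and pm: "p \<cdot> m = x" and rm: "r \<cdot> m = y"
      using pullback_lift[OF pb p r x y xy] .
    have \<phi>\<psi>m: "\<phi> \<cdot> \<psi> \<cdot> m = m"
      using comp_assoc[OF m \<psi> \<phi>] \<phi>\<psi> id_left[OF m] by simp
    show "\<exists>!h. h \<in> hom C X B \<and> (p \<cdot> \<phi>) \<cdot> h = x \<and> (r \<cdot> \<phi>) \<cdot> h = y"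
    proof (intro ex1I conjI)
      show \<psi>m: "\<psi> \<cdot> m \<in> hom C X B" using comp_in_hom[OF m \<psi>] .
      show "(p \<cdot> \<phi>) \<cdot> \<psi> \<cdot> m = x" "(r \<cdot> \<phi>) \<cdot> \<psi> \<cdot> m = y"
        using comp_assoc[OF \<psi>m \<phi> p] comp_assoc[OF \<psi>m \<phi> r] \<phi>\<psi>m pm rm by simp_all
    next
      fix h assume "h \<in> hom C X B \<and> (p \<cdot> \<phi>) \<cdot> h = x \<and> (r \<cdot> \<phi>) \<cdot> h = y"
      then have h: "h \<in> hom C X B" and eq: "p \<cdot> \<phi> \<cdot> h = p \<cdot> m" "r \<cdot> \<phi> \<cdot> h = r \<cdot> m"
        using comp_assoc[OF _ \<phi> p] comp_assoc[OF _ \<phi> r] pm rm by auto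
      have "\<phi> \<cdot> h = m"
        using pullback_jointly_monic[OF pb p r comp_in_hom[OF h \<phi>] m eq] .
      then show "h = \<psi> \<cdot> m"
        using comp_assoc[OF h \<phi> \<psi>] \<psi>\<phi> id_left[OF h] by simp
    qed
  qed
qed

end

text \<open>
  The shape \<open>0 \<rightarrow> 2 \<leftarrow> 1\<close>: the arrows \<open>0, 1, 2\<close> are the identities, \<open>3 : 0 \<rightarrow> 2\<close> and \<open>4 : 1 \<rightarrow> 2\<close>.
  In a composable pair at least one arrow is an identity, so it suffices to return the other one.
\<close>

definition cospan_shape :: "(nat, nat) cat" where
  "cospan_shape = \<lparr>Obj = {0, 1, 2}, Arr = {0, 1, 2, 3, 4},
     cat.Dom = (\<lambda>u. if u = 3 then 0 else if u = 4 then 1 else u),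
     cat.Cod = (\<lambda>u. if u < 3 then u else 2),
     Ident = (\<lambda>i. i), Comp = (\<lambda>v u. if v < 3 then u else v)\<rparr>"

lemma category_cospan_shape: "category cospan_shape"
  by unfold_locales (auto simp: cospan_shape_def hom_def split: if_splits)

context category
begin

lemma pullback_exists:
  assumes lim: "has_finite_limits C" and f: "f \<in> hom C A D" and g: "g \<in> hom C B D"
  obtains P p q where "p \<in> hom C P A" "q \<in> hom C P B" "is_pullback C p q f g"
proof -
  define Fo where "Fo i = (if i = 0 then A else if i = 1 then B else D)" for i :: nat
  define Fa where "Fa u = (if u < 3 then \<one> (Fo u) else if u = 3 then f else g)" for u :: nat
  note S = cospan_shape_def Fo_def Fa_def
  have "cat_functor cospan_shape C Fo Fa"
  proof (intro cat_functor.intro category_cospan_shape category_axioms cat_functor_axioms.intro)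
    fix i j k u v
    show "i \<in> Obj cospan_shape \<Longrightarrow> Fo i \<in> Obj C"
      using homD[OF f] homD[OF g] by (auto simp: S)
    show "i \<in> Obj cospan_shape \<Longrightarrow> Fa (\<one>\<^bsub>cospan_shape\<^esub> i) = \<one> (Fo i)"
      by (auto simp: S)
    show Fa: "Fa u \<in> hom C (Fo i) (Fo j)" if "u \<in> hom cospan_shape i j" for u i j
    proof -
      have "u < 3 \<and> j = i \<and> i = u \<or> u = 3 \<and> i = 0 \<and> j = 2 \<or> u = 4 \<and> i = 1 \<and> j = 2"
        using that unfolding hom_def by (auto simp: cospan_shape_def)
      then show ?thesis
        using f g homD(4,5)[OF f] homD(4)[OF g] id_in_hom by (auto simp: Fo_def Fa_def)
    qed
    show "Fa (v \<cdot>\<^bsub>cospan_shape\<^esub> u) = Fa v \<cdot> Fa u"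
      if u: "u \<in> hom cospan_shape i j" and v: "v \<in> hom cospan_shape j k"
    proof (cases "v < 3")
      case True
      then have "v \<cdot>\<^bsub>cospan_shape\<^esub> u = u" "Fa v = \<one> (Fo j)"
        using v by (auto simp: S hom_def)
      then show ?thesis using id_left[OF Fa[OF u]] by simp
    next
      case False
      then have "v \<cdot>\<^bsub>cospan_shape\<^esub> u = v" "Fa u = \<one> (Fo j)"
        using u v by (auto simp: S hom_def split: if_splits)
      then show ?thesis using id_right[OF Fa[OF v]] by simp
    qed
  qed
  moreover have "finite (Obj cospan_shape)" "finite (Arr cospan_shape)"
    by (simp_all add: cospan_shape_def)
  ultimately obtain P l where l: "is_limit cospan_shape C Fo Fa P l"
    using lim unfolding has_finite_limits_def by blast
  (* The component of a cone at the corner 2 is forced by either of the other two. *)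
  have cone_iff: "is_cone cospan_shape C Fo Fa X x \<longleftrightarrow>
      x 0 \<in> hom C X A \<and> x 1 \<in> hom C X B \<and> f \<cdot> x 0 = x 2 \<and> g \<cdot> x 1 = x 2" for X x
  proof
    assume "is_cone cospan_shape C Fo Fa X x"
    then show "x 0 \<in> hom C X A \<and> x 1 \<in> hom C X B \<and> f \<cdot> x 0 = x 2 \<and> g \<cdot> x 1 = x 2"
      by (simp add: is_cone_def S)
  next
    assume r: "x 0 \<in> hom C X A \<and> x 1 \<in> hom C X B \<and> f \<cdot> x 0 = x 2 \<and> g \<cdot> x 1 = x 2"
    then have "x 2 \<in> hom C X D" using comp_in_hom[OF _ f, of "x 0" X] by simp
    then show "is_cone cospan_shape C Fo Fa X x"
      using r homD(4) id_left by (auto simp: is_cone_def S)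
  qed
  have l0: "l 0 \<in> hom C P A" and l1: "l 1 \<in> hom C P B" and fl: "f \<cdot> l 0 = l 2" and gl: "g \<cdot> l 1 = l 2"
    using l cone_iff unfolding is_limit_def by auto
  have "is_pullback C (l 0) (l 1) f g"
  proof (rule is_pullbackI[OF l0 l1 f g])
    show "f \<cdot> l 0 = g \<cdot> l 1" using fl gl by simp
  next
    fix X x y assume x: "x \<in> hom C X A" and y: "y \<in> hom C X B" and xy: "f \<cdot> x = g \<cdot> y"
    define z where "z i = (if i = 0 then x else if i = 1 then y else f \<cdot> x)" for i :: nat
    have "is_cone cospan_shape C Fo Fa X z"
      using x y xy by (simp add: cone_iff z_def)
    then have "\<exists>!h. h \<in> hom C X P \<and> (\<forall>i\<in>Obj cospan_shape. l i \<cdot> h = z i)"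
      using l by (simp add: is_limit_def)
    moreover have "h \<in> hom C X P \<and> (\<forall>i\<in>Obj cospan_shape. l i \<cdot> h = z i) \<longleftrightarrow>
        h \<in> hom C X P \<and> l 0 \<cdot> h = x \<and> l 1 \<cdot> h = y" for h
      using comp_assoc[OF _ l0 f, of h X] fl by (auto simp: cospan_shape_def z_def)
    ultimately show "\<exists>!h. h \<in> hom C X P \<and> l 0 \<cdot> h = x \<and> l 1 \<cdot> h = y" by simp
  qed
  with l0 l1 that show thesis by blast
qed

end

section \<open>Zero arrows and normal epimorphisms\<close>

context category
begin

lemma zero_arrow_comp_left:
  assumes f: "f \<in> hom C A B" and g: "g \<in> hom C B D" and z: "is_zero_arrow C f"
  shows "is_zero_arrow C (g \<cdot> f)"
proof -
  obtain Z u v where Z: "is_zero_object C Z" and u: "u \<in> hom C A Z" and v: "v \<in> hom C Z B"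
    and "f = v \<cdot> u"
    using z homD[OF f] by (auto simp: is_zero_arrow_def)
  then have "g \<cdot> f = (g \<cdot> v) \<cdot> u" using comp_assoc[OF u v g] by simp
  with Z u comp_in_hom[OF v g] homD[OF comp_in_hom[OF f g]]
  show ?thesis unfolding is_zero_arrow_def by metis
qed

text \<open>
  The two arrows may factor through different zero objects; the one through \<open>Z'\<close> is redirected
  along the arrow \<open>Z \<rightarrow> Z'\<close>.
\<close>

lemma zero_arrow_unique:
  assumes f: "f \<in> hom C A B" "is_zero_arrow C f" and g: "g \<in> hom C A B" "is_zero_arrow C g"
  shows "f = g"
proof -
  obtain Z u v where Z: "is_zero_object C Z" and u: "u \<in> hom C A Z" and v: "v \<in> hom C Z B"
    and fe: "f = v \<cdot> u"
    using f homD[OF f(1)] by (auto simp: is_zero_arrow_def)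
  obtain Z' u' v' where Z': "is_zero_object C Z'" and u': "u' \<in> hom C A Z'"
    and v': "v' \<in> hom C Z' B" and ge: "g = v' \<cdot> u'"
    using g homD[OF g(1)] by (auto simp: is_zero_arrow_def)
  have "\<exists>!t. t \<in> hom C Z Z'"
    using Z homD(5)[OF u'] by (simp add: is_zero_object_def is_initial_def)
  then obtain t where t: "t \<in> hom C Z Z'" by blast
  have "t \<cdot> u = u'"
    using Z' homD(4)[OF u'] comp_in_hom[OF u t] u'
    unfolding is_zero_object_def is_terminal_def by blast
  moreover have "v' \<cdot> t = v"
    using Z homD(5)[OF v] comp_in_hom[OF t v'] v
    unfolding is_zero_object_def is_initial_def by blast
  ultimately show ?thesis using fe ge comp_assoc[OF u t v'] by simp
qed

lemma cokernel_factor: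
  assumes q: "is_cokernel_of C q k" "q \<in> hom C A B" "k \<in> hom C K A"
    and x: "x \<in> hom C A D" "is_zero_arrow C (x \<cdot> k)"
  shows "\<exists>!h. h \<in> hom C B D \<and> h \<cdot> q = x"
proof -
  have "\<forall>x\<in>Arr C. Dom x = A \<and> is_zero_arrow C (x \<cdot> k) \<longrightarrow> (\<exists>!h. h \<in> hom C B (Cod x) \<and> h \<cdot> q = x)"
    using q(1) unfolding is_cokernel_of_def homD(3)[OF q(2)] homD(3)[OF q(3)] by blast
  then show ?thesis using homD(1-3)[OF x(1)] x(2) by blast
qed

lemma normal_epi_cancel:
  assumes q: "is_normal_epi C q" "q \<in> hom C A B"
    and h: "h \<in> hom C B D" and k: "k \<in> hom C B D" and eq: "h \<cdot> q = k \<cdot> q"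
  shows "h = k"
proof -
  obtain w where w: "is_cokernel_of C q w" using q(1) by (auto simp: is_normal_epi_def)
  then have wh: "w \<in> hom C (Dom w) A" and z: "is_zero_arrow C (q \<cdot> w)"
    using q(2) by (auto simp: is_cokernel_of_def hom_def)
  note hq = comp_in_hom[OF q(2) h]
  have "is_zero_arrow C ((h \<cdot> q) \<cdot> w)"
    using zero_arrow_comp_left[OF comp_in_hom[OF wh q(2)] h z] comp_assoc[OF wh q(2) h] by simp
  then have "\<exists>!m. m \<in> hom C B D \<and> m \<cdot> q = h \<cdot> q"
    using cokernel_factor[OF w q(2) wh hq] by blast
  with h k eq show ?thesis by metis
qed

text \<open>
  If \<open>q\<close> kills nothing more than \<open>f\<close> does, then \<open>f\<close> factors back through \<open>q = \<phi> \<cdot> f\<close>, by the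
  universal property of \<open>q\<close> as a cokernel; that \<open>f\<close> and \<open>q\<close> are epic makes this an inverse of \<open>\<phi>\<close>.
\<close>

lemma factor_of_normal_epis_iso:
  assumes f: "f \<in> hom C A B" "is_normal_epi C f"
    and \<phi>: "\<phi> \<in> hom C B P" and q: "is_normal_epi C (\<phi> \<cdot> f)"
    and kill: "\<And>K y. \<lbrakk>y \<in> hom C K A; is_zero_arrow C ((\<phi> \<cdot> f) \<cdot> y)\<rbrakk> \<Longrightarrow> is_zero_arrow C (f \<cdot> y)"
  obtains \<psi> where "\<psi> \<in> hom C P B" "\<psi> \<cdot> \<phi> = \<one> B" "\<phi> \<cdot> \<psi> = \<one> P"
proof -
  note qh = comp_in_hom[OF f(1) \<phi>]
  obtain w where w: "is_cokernel_of C (\<phi> \<cdot> f) w" using q by (auto simp: is_normal_epi_def)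
  then have wh: "w \<in> hom C (Dom w) A" and z: "is_zero_arrow C ((\<phi> \<cdot> f) \<cdot> w)"
    using homD[OF qh] by (auto simp: is_cokernel_of_def hom_def)
  obtain \<psi> where \<psi>: "\<psi> \<in> hom C P B" and \<psi>q: "\<psi> \<cdot> \<phi> \<cdot> f = f"
    using cokernel_factor[OF w qh wh f(1) kill[OF wh z]] by blast
  have B: "B \<in> Obj C" and P: "P \<in> Obj C" using homD[OF \<phi>] by auto
  have "(\<psi> \<cdot> \<phi>) \<cdot> f = \<one> B \<cdot> f"
    using \<psi>q comp_assoc[OF f(1) \<phi> \<psi>] id_left[OF f(1)] by simp
  then have "\<psi> \<cdot> \<phi> = \<one> B"
    using normal_epi_cancel[OF f(2,1) comp_in_hom[OF \<phi> \<psi>] id_in_hom[OF B]] by blast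
  moreover have "(\<phi> \<cdot> \<psi>) \<cdot> (\<phi> \<cdot> f) = \<one> P \<cdot> (\<phi> \<cdot> f)"
    using \<psi>q comp_assoc[OF qh \<psi> \<phi>] id_left[OF qh] by simp
  then have "\<phi> \<cdot> \<psi> = \<one> P"
    using normal_epi_cancel[OF q qh comp_in_hom[OF \<psi> \<phi>] id_in_hom[OF P]] by blast
  ultimately show thesis using \<psi> that by blast
qed

end

context pointed_category
begin

lemma zero_arrow_exists:
  assumes "A \<in> Obj C" "B \<in> Obj C"
  obtains z where "z \<in> hom C A B" "is_zero_arrow C z"
proof -
  obtain Z where Z: "is_zero_object C Z" using has_zero_object by blast
  then have "\<exists>!u. u \<in> hom C A Z" "\<exists>!v. v \<in> hom C Z B"
    using assms by (simp_all add: is_zero_object_def is_initial_def is_terminal_def)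
  then obtain u v where u: "u \<in> hom C A Z" and v: "v \<in> hom C Z B" by blast
  have "is_zero_arrow C (v \<cdot> u)"
    using Z u v homD[OF comp_in_hom[OF u v]] unfolding is_zero_arrow_def by blast
  then show thesis using that comp_in_hom[OF u v] by blast
qed

text \<open>
  The element-free form of \<open>Ker f \<cong> Ker f' \<cong> Ker (\<phi> \<cdot> f)\<close>: an arrow killed by \<open>\<phi> \<cdot> f\<close> has an image
  under \<open>a\<close> killed by \<open>f'\<close>; the pullback along \<open>b\<close> lifts that image to an arrow killed by \<open>f\<close>, and
  the pullback along \<open>r\<close> allows only one lift, namely the arrow one began with.
\<close>

lemma killed_by_composite_killed_by_pullback:
  assumes f: "f \<in> hom C A B" and \<phi>: "\<phi> \<in> hom C B P" and r: "r \<in> hom C P B'"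
    and a: "a \<in> hom C A A'" and f': "f' \<in> hom C A' B'"
    and pb1: "is_pullback C f a (r \<cdot> \<phi>) f'" and pb2: "is_pullback C (\<phi> \<cdot> f) a r f'"
    and y: "y \<in> hom C K A" and zero: "is_zero_arrow C ((\<phi> \<cdot> f) \<cdot> y)"
  shows "is_zero_arrow C (f \<cdot> y)"
proof -
  note q = comp_in_hom[OF f \<phi>] and b = comp_in_hom[OF \<phi> r]
  obtain z where z: "z \<in> hom C K B" "is_zero_arrow C z"
    using zero_arrow_exists homD[OF y] homD[OF f] by blast
  have "is_zero_arrow C (f' \<cdot> a \<cdot> y)"
    using zero_arrow_comp_left[OF comp_in_hom[OF y q] r zero] comp_assoc[OF y q r]
      comp_assoc[OF y a f'] pullback_commutes[OF pb2] by simp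
  then have "(r \<cdot> \<phi>) \<cdot> z = f' \<cdot> a \<cdot> y"
    using zero_arrow_unique comp_in_hom[OF z(1) b] zero_arrow_comp_left[OF z(1) b z(2)]
      comp_in_hom[OF comp_in_hom[OF y a] f'] by blast
  then obtain h where h: "h \<in> hom C K A" and fh: "f \<cdot> h = z" and ah: "a \<cdot> h = a \<cdot> y"
    using pullback_lift[OF pb1 f a z(1) comp_in_hom[OF y a]] by blast
  have "is_zero_arrow C ((\<phi> \<cdot> f) \<cdot> h)"
    using zero_arrow_comp_left[OF z(1) \<phi> z(2)] comp_assoc[OF h f \<phi>] fh by simp
  then have "(\<phi> \<cdot> f) \<cdot> h = (\<phi> \<cdot> f) \<cdot> y"
    using zero_arrow_unique comp_in_hom[OF h q] comp_in_hom[OF y q] zero by blast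
  then have "h = y" using pullback_jointly_monic[OF pb2 q a h y] ah by blast
  with fh z(2) show ?thesis by simp
qed

end

section \<open>Cancellation of pullbacks along a normal epimorphism\<close>

theorem proposition2p6:
  fixes C :: "('o, 'm) cat"
  assumes "prenormal_category C"
    and "f \<in> hom C A B" and "g \<in> hom C B D"
    and "f' \<in> hom C A' B'" and "g' \<in> hom C B' D'"
    and "a \<in> hom C A A'" and "b \<in> hom C B B'" and "c \<in> hom C D D'"
    and "b \<cdot>\<^bsub>C\<^esub> f = f' \<cdot>\<^bsub>C\<^esub> a"
    and "c \<cdot>\<^bsub>C\<^esub> g = g' \<cdot>\<^bsub>C\<^esub> b"
    and "is_normal_epi C f'"
    and "is_pullback C (g \<cdot>\<^bsub>C\<^esub> f) a c (g' \<cdot>\<^bsub>C\<^esub> f')"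
    and "is_pullback C f a b f'"
  shows "is_pullback C g b c g'"
proof -
  interpret prenormal_category C by fact
  note f = assms(2) and g = assms(3) and f' = assms(4) and g' = assms(5)
    and a = assms(6) and b = assms(7) and c = assms(8)
    and left = assms(13)
  obtain P p r where p: "p \<in> hom C P D" and r: "r \<in> hom C P B'" and pb: "is_pullback C p r c g'"
    using pullback_exists[OF finite_limits c g'] .
  obtain \<phi> where \<phi>: "\<phi> \<in> hom C B P" and p\<phi>: "p \<cdot>\<^bsub>C\<^esub> \<phi> = g" and r\<phi>: "r \<cdot>\<^bsub>C\<^esub> \<phi> = b"
    using pullback_lift[OF pb p r g b assms(10)] .
  have "r \<cdot>\<^bsub>C\<^esub> \<phi> \<cdot>\<^bsub>C\<^esub> f = f' \<cdot>\<^bsub>C\<^esub> a"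
    using comp_assoc[OF f \<phi> r] r\<phi> assms(9) by simp
  moreover have "is_pullback C (p \<cdot>\<^bsub>C\<^esub> \<phi> \<cdot>\<^bsub>C\<^esub> f) a c (g' \<cdot>\<^bsub>C\<^esub> f')"
    using comp_assoc[OF f \<phi> p] p\<phi> assms(12) by simp
  ultimately have left': "is_pullback C (\<phi> \<cdot>\<^bsub>C\<^esub> f) a r f'"
    by (rule pullback_cancel[OF comp_in_hom[OF f \<phi>] p a r c f' g' _ pb])
  have "is_normal_epi C f" "is_normal_epi C (\<phi> \<cdot>\<^bsub>C\<^esub> f)"
    using normal_epis_pullback_stable[OF assms(11)] left left' by blast+
  then obtain \<psi> where "\<psi> \<in> hom C P B" "\<psi> \<cdot>\<^bsub>C\<^esub> \<phi> = \<one>\<^bsub>C\<^esub> B" "\<phi> \<cdot>\<^bsub>C\<^esub> \<psi> = \<one>\<^bsub>C\<^esub> P"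
    using factor_of_normal_epis_iso[OF f _ \<phi>]
      killed_by_composite_killed_by_pullback[OF f \<phi> r a f' left[folded r\<phi>] left'] by blast
  then have "is_pullback C (p \<cdot>\<^bsub>C\<^esub> \<phi>) (r \<cdot>\<^bsub>C\<^esub> \<phi>) c g'"
    using pullback_precomp_iso[OF pb p r \<phi>] by blast
  then show ?thesis by (simp add: p\<phi> r\<phi>)
qed

end
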